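(* Let $\mathcal{C}$ be a modular quasiminimal class and $(M,P)$ a beautiful pair associated to $\mathcal{C}$. The notion of independence $\perp^{\operatorname{cl},P}$ satisfies symmetry: for all finite tuples $\vec a,\vec b$ in $M$ and all $C\subseteq M$, if $\vec a\perp^{\operatorname{cl},P}_C\vec b$ then $\vec b\perp^{\operatorname{cl},P}_C\vec a$.
   Context: **Quasiminimal classes.** Let $\mathcal{L}$ be a countable language. $\operatorname{tp}$ denotes the quantifier-free $\mathcal{L}$-type of a (possibly infinite, enumerated) tuple; in the structures below it is identified with the $\mathcal{L}_{\omega_1\omega}$-type. An $\mathcal{L}$-structure $M$ equipped with a pregeometry $\operatorname{cl}$ is a *quasiminimal pregeometry structure* if: (QM1) if $\operatorname{tp}(a,\vec b)=\operatorname{tp}(a',\vec b')$ then $a\in\operatorname{cl}(\vec b)$ iff $a'\in\operatorname{cl}(\vec b')$; (QM2) $M$ is infinite-dimensional with respect to $\operatorname{cl}$; (QM3) $\operatorname{cl}(A)$ is countable for every finite $A\subseteq M$; (QM4) if $A,A'\subseteq M$ are countable closed subsets enumerated so that $\operatorname{tp}(A)=\operatorname{tp}(A')$, $a\in M\setminus A$ and $a'\in M\setminus A'$, then $\operatorname{tp}(A,a)=\operatorname{tp}(A',a')$; (QM5) if $A,A'\subseteq M$ are countable closed subsets or empty, enumerated so that $\operatorname{tp}(A)=\operatorname{tp}(A')$, $\vec b,\vec b'$ are finite tuples with $\operatorname{tp}(A,\vec b)=\operatorname{tp}(A',\vec b')$ and $a\in\operatorname{cl}(A,\vec b)$, then there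 is $a'\in M$ with $\operatorname{tp}(A,\vec b,a)=\operatorname{tp}(A',\vec b',a')$. It is a *weakly quasiminimal pregeometry structure* if all axioms except possibly QM2 hold. An embedding $\theta:M_1\to M_2$ of such structures is *closed* if $\theta(\operatorname{cl}_{M_1}(A))=\operatorname{cl}_{M_2}(\theta(A))$ for all $A\subseteq M_1$; $M_1\preceq M_2$ means that the inclusion is a closed embedding. A *quasiminimal class* $\mathcal{C}$ is the smallest class of $\mathcal{L}$-structures containing a given quasiminimal pregeometry structure and closed under isomorphism, closed substructures, and unions of chains of closed embeddings; each member is a weakly quasiminimal pregeometry structure with its pregeometry $\operatorname{cl}$. $\dim(\vec a/B)$ is the dimension of $\vec a$ in the localized pregeometry $\operatorname{cl}_B(X)=\operatorname{cl}(X\cup B)$, and $\vec a\perp^{\operatorname{cl}}_C B$ means $\dim(\vec a/B\cup C)=\dim(\vec a/C)$. $\mathcal{C}$ is *modular* if for all $M\in\mathcal{C}$ and all finite tuples $\vec a,\vec b$ in $M$, $\vec a\perp^{\operatorname{cl}}_{\operatorname{cl}(\vec a)\cap\operatorname{cl}(\vec b)}\vec b$. **Beautiful pairs.** Let $P$ be a new unary predicate and $M\in\mathcal{C}$. $(M,P)$ is *dense-codense* if for all $b_1,\dots,b_n\in M$: (density) some $a\in P(M)$ realizes the unique generic type over $\operatorname{cl}(b_1,\dots,b_n)$, i.e. $a\notin\operatorname{cl}(b_1,\dots,b_n)$; (codensity) there is $a\in M$ with $a\notin\operatorname{cl}(\{b_1,\dots,b_n\}\cup P(M))$. It is a *beautiful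 pair* if in addition $P(M)\in\mathcal{C}$ and $P(M)\preceq M$. **Independence.** $\dim_{\operatorname{scl}}(\vec a/B):=\dim(\vec a/B\cup P(M))$. For $B\subseteq C\subseteq M$, $\vec a\perp^{\operatorname{cl},P}_B C$ means $\dim(\vec a/B)=\dim(\vec a/C)$ and $\dim_{\operatorname{scl}}(\vec a/B)=\dim_{\operatorname{scl}}(\vec a/C)$. For arbitrary $B,C$, $\vec a\perp^{\operatorname{cl},P}_B C$ means $\vec a\perp^{\operatorname{cl},P}_B B\cup C$. *)

theory Defs
  imports Complex_Main "HOL-Library.Countable_Set"
begin

section \<open>Languages, structures and quantifier-free types\<close>

text \<open>Constant symbols are function symbols of arity 0.\<close>

record ('f, 'r) lang =
  fsyms :: "'f set"
  rsyms :: "'r set"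
  farity :: "'f \<Rightarrow> nat"
  rarity :: "'r \<Rightarrow> nat"

definition countable_language :: "('f, 'r) lang \<Rightarrow> bool" where
  "countable_language L \<longleftrightarrow> countable (fsyms L) \<and> countable (rsyms L)"

record ('a, 'f, 'r) lstruct =
  carr :: "'a set"
  fint :: "'f \<Rightarrow> 'a list \<Rightarrow> 'a"
  rint :: "'r \<Rightarrow> 'a list \<Rightarrow> bool"

definition tuples :: "('a, 'f, 'r, 'z) lstruct_scheme \<Rightarrow> nat \<Rightarrow> 'a list set" where
  "tuples M n = {xs. set xs \<subseteq> carr M \<and> length xs = n}"

definition L_structure :: "('f, 'r) lang \<Rightarrow> ('a, 'f, 'r, 'z) lstruct_scheme \<Rightarrow> bool" where
  "L_structure L M \<longleftrightarrow>
     (\<forall>f\<in>fsyms L. \<forall>xs\<in>tuples M (farity L f). fint M f xs \<in> carr M)"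

datatype ('f, 'v) trm = TVar 'v | TFun 'f "('f, 'v) trm list"

datatype ('f, 'r, 'v) qf =
    QBot
  | QEq "('f, 'v) trm" "('f, 'v) trm"
  | QRel 'r "('f, 'v) trm list"
  | QNeg "('f, 'r, 'v) qf"
  | QConj "('f, 'r, 'v) qf" "('f, 'r, 'v) qf"

fun wf_trm :: "('f, 'r) lang \<Rightarrow> 'v set \<Rightarrow> ('f, 'v) trm \<Rightarrow> bool" where
  "wf_trm L V (TVar v) \<longleftrightarrow> v \<in> V"
| "wf_trm L V (TFun f ts) \<longleftrightarrow>
     f \<in> fsyms L \<and> length ts = farity L f \<and> (\<forall>t\<in>set ts. wf_trm L V t)"

fun wf_qf :: "('f, 'r) lang \<Rightarrow> 'v set \<Rightarrow> ('f, 'r, 'v) qf \<Rightarrow> bool" where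
  "wf_qf L V QBot \<longleftrightarrow> True"
| "wf_qf L V (QEq s t) \<longleftrightarrow> wf_trm L V s \<and> wf_trm L V t"
| "wf_qf L V (QRel r ts) \<longleftrightarrow>
     r \<in> rsyms L \<and> length ts = rarity L r \<and> (\<forall>t\<in>set ts. wf_trm L V t)"
| "wf_qf L V (QNeg p) \<longleftrightarrow> wf_qf L V p"
| "wf_qf L V (QConj p q) \<longleftrightarrow> wf_qf L V p \<and> wf_qf L V q"

fun trm_val :: "('a, 'f, 'r, 'z) lstruct_scheme \<Rightarrow> ('v \<Rightarrow> 'a) \<Rightarrow> ('f, 'v) trm \<Rightarrow> 'a" where
  "trm_val M e (TVar v) = e v"
| "trm_val M e (TFun f ts) = fint M f (map (trm_val M e) ts)"

fun qf_sat :: "('a, 'f, 'r, 'z) lstruct_scheme \<Rightarrow> ('v \<Rightarrow> 'a) \<Rightarrow> ('f, 'r, 'v) qf \<Rightarrow> bool" where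
  "qf_sat M e QBot \<longleftrightarrow> False"
| "qf_sat M e (QEq s t) \<longleftrightarrow> trm_val M e s = trm_val M e t"
| "qf_sat M e (QRel r ts) \<longleftrightarrow> rint M r (map (trm_val M e) ts)"
| "qf_sat M e (QNeg p) \<longleftrightarrow> \<not> qf_sat M e p"
| "qf_sat M e (QConj p q) \<longleftrightarrow> qf_sat M e p \<and> qf_sat M e q"

text \<open>The quantifier-free type of the tuple \<open>(e i | i \<in> I)\<close>; the index set \<open>I\<close> may be
  infinite and serves as the set of variables.\<close>

definition tp :: "('f, 'r) lang \<Rightarrow> ('a, 'f, 'r, 'z) lstruct_scheme \<Rightarrow> 'v set \<Rightarrow> ('v \<Rightarrow> 'a)
    \<Rightarrow> ('f, 'r, 'v) qf set" where
  "tp L M I e = {p. wf_qf L I p \<and> qf_sat M e p}"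

definition tp_list :: "('f, 'r) lang \<Rightarrow> ('a, 'f, 'r, 'z) lstruct_scheme \<Rightarrow> 'a list
    \<Rightarrow> ('f, 'r, nat) qf set" where
  "tp_list L M xs = tp L M {..<length xs} ((!) xs)"

text \<open>The type of the family \<open>(e i | i \<in> I)\<close> followed by the finite tuple \<open>xs\<close>.\<close>

definition tp_ext :: "('f, 'r) lang \<Rightarrow> ('a, 'f, 'r, 'z) lstruct_scheme \<Rightarrow> 'v set \<Rightarrow> ('v \<Rightarrow> 'a)
    \<Rightarrow> 'a list \<Rightarrow> ('f, 'r, 'v + nat) qf set" where
  "tp_ext L M I e xs = tp L M (I <+> {..<length xs}) (case_sum e ((!) xs))"


section \<open>Pregeometries and dimension\<close>

definition pregeometry :: "'a set \<Rightarrow> ('a set \<Rightarrow> 'a set) \<Rightarrow> bool" where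
  "pregeometry S c \<longleftrightarrow>
     (\<forall>A. A \<subseteq> S \<longrightarrow> A \<subseteq> c A \<and> c A \<subseteq> S) \<and>
     (\<forall>A B. A \<subseteq> B \<and> B \<subseteq> S \<longrightarrow> c A \<subseteq> c B) \<and>
     (\<forall>A. A \<subseteq> S \<longrightarrow> c (c A) = c A) \<and>
     (\<forall>A x. A \<subseteq> S \<and> x \<in> c A \<longrightarrow> (\<exists>F. finite F \<and> F \<subseteq> A \<and> x \<in> c F)) \<and>
     (\<forall>A x y. A \<subseteq> S \<and> x \<in> S \<and> y \<in> S \<and> x \<in> c (insert y A) - c A \<longrightarrow> y \<in> c (insert x A))"

definition cl_independent :: "('a set \<Rightarrow> 'a set) \<Rightarrow> 'a set \<Rightarrow> bool" where
  "cl_independent c Y \<longleftrightarrow> (\<forall>y\<in>Y. y \<notin> c (Y - {y}))"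

definition is_basis :: "('a set \<Rightarrow> 'a set) \<Rightarrow> 'a set \<Rightarrow> 'a set \<Rightarrow> bool" where
  "is_basis c X Y \<longleftrightarrow> Y \<subseteq> X \<and> cl_independent c Y \<and> X \<subseteq> c Y"

definition localize :: "('a set \<Rightarrow> 'a set) \<Rightarrow> 'a set \<Rightarrow> 'a set \<Rightarrow> 'a set" where
  "localize c B X = c (X \<union> B)"

text \<open>\<open>cl_dim c as B\<close> is the dimension of the tuple \<open>as\<close> over \<open>B\<close>. In a pregeometry all bases of
  a set have the same cardinality, so the choice of basis is immaterial.\<close>

definition cl_dim :: "('a set \<Rightarrow> 'a set) \<Rightarrow> 'a list \<Rightarrow> 'a set \<Rightarrow> nat" where
  "cl_dim c as B = card (SOME Y. is_basis (localize c B) (set as) Y)"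


section \<open>Quasiminimal pregeometry structures\<close>

record ('a, 'f, 'r) clstruct = "('a, 'f, 'r) lstruct" +
  cl :: "'a set \<Rightarrow> 'a set"

definition cl_closed :: "('a, 'f, 'r) clstruct \<Rightarrow> 'a set \<Rightarrow> bool" where
  "cl_closed M A \<longleftrightarrow> A \<subseteq> carr M \<and> cl M A = A"

definition QM1 :: "('f, 'r) lang \<Rightarrow> ('a, 'f, 'r) clstruct \<Rightarrow> bool" where
  "QM1 L M \<longleftrightarrow>
     (\<forall>a a' bs bs'. set (a # bs) \<subseteq> carr M \<and> set (a' # bs') \<subseteq> carr M \<and>
        length bs = length bs' \<and> tp_list L M (a # bs) = tp_list L M (a' # bs')
        \<longrightarrow> (a \<in> cl M (set bs) \<longleftrightarrow> a' \<in> cl M (set bs')))"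

definition QM2 :: "('a, 'f, 'r) clstruct \<Rightarrow> bool" where
  "QM2 M \<longleftrightarrow> (\<exists>Y. is_basis (cl M) (carr M) Y \<and> infinite Y)"

definition QM3 :: "('a, 'f, 'r) clstruct \<Rightarrow> bool" where
  "QM3 M \<longleftrightarrow> (\<forall>A. A \<subseteq> carr M \<and> finite A \<longrightarrow> countable (cl M A))"

text \<open>Enumerations of countable sets are indexed by sets of natural numbers, so that finite and
  empty sets are covered.\<close>

definition QM4 :: "('f, 'r) lang \<Rightarrow> ('a, 'f, 'r) clstruct \<Rightarrow> bool" where
  "QM4 L M \<longleftrightarrow>
     (\<forall>(I :: nat set) e e' a a'.
        cl_closed M (e ` I) \<and> cl_closed M (e' ` I) \<and> tp L M I e = tp L M I e' \<and>
        a \<in> carr M - e ` I \<and> a' \<in> carr M - e' ` I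
        \<longrightarrow> tp_ext L M I e [a] = tp_ext L M I e' [a'])"

definition QM5 :: "('f, 'r) lang \<Rightarrow> ('a, 'f, 'r) clstruct \<Rightarrow> bool" where
  "QM5 L M \<longleftrightarrow>
     (\<forall>(I :: nat set) e e' bs bs' a.
        (cl_closed M (e ` I) \<or> e ` I = {}) \<and> (cl_closed M (e' ` I) \<or> e' ` I = {}) \<and>
        tp L M I e = tp L M I e' \<and>
        set bs \<subseteq> carr M \<and> set bs' \<subseteq> carr M \<and> length bs = length bs' \<and>
        tp_ext L M I e bs = tp_ext L M I e' bs' \<and>
        a \<in> cl M (e ` I \<union> set bs)
        \<longrightarrow> (\<exists>a'\<in>carr M. tp_ext L M I e (bs @ [a]) = tp_ext L M I e' (bs' @ [a'])))"

definition weakly_qm_pregeometry_structure ::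
    "('f, 'r) lang \<Rightarrow> ('a, 'f, 'r) clstruct \<Rightarrow> bool" where
  "weakly_qm_pregeometry_structure L M \<longleftrightarrow>
     L_structure L M \<and> pregeometry (carr M) (cl M) \<and> QM1 L M \<and> QM3 M \<and> QM4 L M \<and> QM5 L M"

definition qm_pregeometry_structure :: "('f, 'r) lang \<Rightarrow> ('a, 'f, 'r) clstruct \<Rightarrow> bool" where
  "qm_pregeometry_structure L M \<longleftrightarrow> weakly_qm_pregeometry_structure L M \<and> QM2 M"


section \<open>Closed embeddings and quasiminimal classes\<close>

definition embedding :: "('f, 'r) lang \<Rightarrow> ('a \<Rightarrow> 'b) \<Rightarrow> ('a, 'f, 'r, 'y) lstruct_scheme
    \<Rightarrow> ('b, 'f, 'r, 'z) lstruct_scheme \<Rightarrow> bool" where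
  "embedding L h M N \<longleftrightarrow>
     L_structure L M \<and> L_structure L N \<and> h ` carr M \<subseteq> carr N \<and> inj_on h (carr M) \<and>
     (\<forall>f\<in>fsyms L. \<forall>xs\<in>tuples M (farity L f). h (fint M f xs) = fint N f (map h xs)) \<and>
     (\<forall>r\<in>rsyms L. \<forall>xs\<in>tuples M (rarity L r). rint M r xs \<longleftrightarrow> rint N r (map h xs))"

text \<open>The values of \<open>cl M\<close> matter only on subsets of \<open>carr M\<close>. The last two conditions say that
  there they are again subsets of \<open>carr M\<close>; hence the image of a closed embedding is a closed
  set.\<close>

definition closed_embedding :: "('f, 'r) lang \<Rightarrow> ('a \<Rightarrow> 'b) \<Rightarrow> ('a, 'f, 'r) clstruct
    \<Rightarrow> ('b, 'f, 'r) clstruct \<Rightarrow> bool" where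
  "closed_embedding L h M N \<longleftrightarrow>
     embedding L h M N \<and>
     (\<forall>A. A \<subseteq> carr M \<longrightarrow> h ` cl M A = cl N (h ` A)) \<and>
     (\<forall>A. A \<subseteq> carr M \<longrightarrow> cl M A \<subseteq> carr M) \<and>
     (\<forall>A. A \<subseteq> carr N \<longrightarrow> cl N A \<subseteq> carr N)"

definition isomorphism :: "('f, 'r) lang \<Rightarrow> ('a \<Rightarrow> 'b) \<Rightarrow> ('a, 'f, 'r) clstruct
    \<Rightarrow> ('b, 'f, 'r) clstruct \<Rightarrow> bool" where
  "isomorphism L h M N \<longleftrightarrow> closed_embedding L h M N \<and> h ` carr M = carr N"

definition closed_sub :: "('f, 'r) lang \<Rightarrow> ('a, 'f, 'r) clstruct \<Rightarrow> ('a, 'f, 'r) clstruct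
    \<Rightarrow> bool" where
  "closed_sub L M N \<longleftrightarrow> carr M \<subseteq> carr N \<and> closed_embedding L id M N"

text \<open>The closure operator of the union of a chain is the union of the closure operators. The
  interpretation of the symbols is determined by the inclusions.\<close>

definition chain_union :: "('f, 'r) lang \<Rightarrow> ('a, 'f, 'r) clstruct set \<Rightarrow> ('a, 'f, 'r) clstruct
    \<Rightarrow> bool" where
  "chain_union L K N \<longleftrightarrow>
     K \<noteq> {} \<and> (\<forall>M1\<in>K. \<forall>M2\<in>K. closed_sub L M1 M2 \<or> closed_sub L M2 M1) \<and>
     carr N = (\<Union>M\<in>K. carr M) \<and>
     (\<forall>A. A \<subseteq> carr N \<longrightarrow> cl N A = (\<Union>M\<in>K. cl M (A \<inter> carr M))) \<and>
     (\<forall>M\<in>K. closed_sub L M N)"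

text \<open>Classes consist of structures with carriers in one type \<open>'a\<close>, which is arbitrary and plays
  the role of a universe. Members carry their closure operator. As there is closure under
  isomorphism, it suffices to consider chains of inclusions.\<close>

inductive_set generated_class ::
    "('f, 'r) lang \<Rightarrow> ('a, 'f, 'r) clstruct \<Rightarrow> ('a, 'f, 'r) clstruct set"
  for L :: "('f, 'r) lang" and M0 :: "('a, 'f, 'r) clstruct" where
  base: "M0 \<in> generated_class L M0"
| iso: "M \<in> generated_class L M0 \<Longrightarrow> isomorphism L h M N \<Longrightarrow> N \<in> generated_class L M0"
| sub: "M \<in> generated_class L M0 \<Longrightarrow> closed_sub L N M \<Longrightarrow> N \<in> generated_class L M0"
| union: "(\<And>M. M \<in> K \<Longrightarrow> M \<in> generated_class L M0) \<Longrightarrow> chain_union L K N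
    \<Longrightarrow> N \<in> generated_class L M0"

definition quasiminimal_class :: "('f, 'r) lang \<Rightarrow> ('a, 'f, 'r) clstruct set \<Rightarrow> bool" where
  "quasiminimal_class L \<C> \<longleftrightarrow>
     (\<exists>M0. qm_pregeometry_structure L M0 \<and> \<C> = generated_class L M0)"


section \<open>Modularity, beautiful pairs and independence\<close>

definition indep_cl :: "('a, 'f, 'r) clstruct \<Rightarrow> 'a list \<Rightarrow> 'a set \<Rightarrow> 'a set \<Rightarrow> bool" where
  "indep_cl M as C B \<longleftrightarrow> cl_dim (cl M) as (B \<union> C) = cl_dim (cl M) as C"

definition modular_class :: "('a, 'f, 'r) clstruct set \<Rightarrow> bool" where
  "modular_class \<C> \<longleftrightarrow>
     (\<forall>M\<in>\<C>. \<forall>as bs. set as \<subseteq> carr M \<and> set bs \<subseteq> carr M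
        \<longrightarrow> indep_cl M as (cl M (set as) \<inter> cl M (set bs)) (set bs))"

definition dense_codense :: "('a, 'f, 'r) clstruct \<Rightarrow> 'a set \<Rightarrow> bool" where
  "dense_codense M P \<longleftrightarrow>
     (\<forall>bs. set bs \<subseteq> carr M \<longrightarrow>
        (\<exists>a\<in>P. a \<notin> cl M (set bs)) \<and>
        (\<exists>a\<in>carr M. a \<notin> cl M (set bs \<union> P)))"

definition beautiful_pair :: "('f, 'r) lang \<Rightarrow> ('a, 'f, 'r) clstruct set
    \<Rightarrow> ('a, 'f, 'r) clstruct \<Rightarrow> 'a set \<Rightarrow> bool" where
  "beautiful_pair L \<C> M P \<longleftrightarrow>
     M \<in> \<C> \<and> P \<subseteq> carr M \<and> dense_codense M P \<and>
     (\<exists>N\<in>\<C>. carr N = P \<and> closed_sub L N M)"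

definition dim_scl :: "('a, 'f, 'r) clstruct \<Rightarrow> 'a set \<Rightarrow> 'a list \<Rightarrow> 'a set \<Rightarrow> nat" where
  "dim_scl M P as B = cl_dim (cl M) as (B \<union> P)"

text \<open>Independence of \<open>as\<close> from \<open>C\<close> over \<open>B\<close>, first for \<open>B \<subseteq> C\<close> and then in general.\<close>

definition indep_clP_sub :: "('a, 'f, 'r) clstruct \<Rightarrow> 'a set \<Rightarrow> 'a list \<Rightarrow> 'a set \<Rightarrow> 'a set
    \<Rightarrow> bool" where
  "indep_clP_sub M P as B C \<longleftrightarrow>
     cl_dim (cl M) as B = cl_dim (cl M) as C \<and> dim_scl M P as B = dim_scl M P as C"

definition indep_clP :: "('a, 'f, 'r) clstruct \<Rightarrow> 'a set \<Rightarrow> 'a list \<Rightarrow> 'a set \<Rightarrow> 'a set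
    \<Rightarrow> bool" where
  "indep_clP M P as B C \<longleftrightarrow> indep_clP_sub M P as B (B \<union> C)"

end

theory Submission
  imports Defs
begin

text \<open>
  The relation in question is the conjunction of two instances of one relation, namely
  \<open>dim(a/B) = dim(a/B \<union> b)\<close> for \<open>B = C\<close> and for \<open>B = C \<union> P(M)\<close>. In any pregeometry this relation is
  symmetric in \<open>a\<close> and \<open>b\<close>: by additivity (lemma \<open>cl_dim_append\<close>),
  \<open>dim(b/B) + dim(a/B \<union> b) = dim(ab/B) = dim(a/B) + dim(b/B \<union> a)\<close>,
  so \<open>a\<close> loses no dimension over \<open>b\<close> exactly if \<open>b\<close> loses none over \<open>a\<close>. Additivity holds because
  a basis of \<open>b\<close> over \<open>B\<close> and a basis of \<open>a\<close> over \<open>B \<union> b\<close> together form a basis of \<open>ab\<close> over \<open>B\<close>,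
  and because the cardinality of a finite basis is determined by Steinitz exchange.

  What remains is that every member of a quasiminimal class is a pregeometry. This goes by
  induction on the generation of the class (lemma \<open>pregeometry_generated_class\<close>); only
  unions of chains need an argument, where finite character puts every closure
  computation into a single member of the chain.
\<close>

section \<open>Pregeometries\<close>

lemma pregeometryI:
  assumes "\<And>A. A \<subseteq> S \<Longrightarrow> A \<subseteq> c A"
    and "\<And>A. A \<subseteq> S \<Longrightarrow> c A \<subseteq> S"
    and "\<And>A B. A \<subseteq> B \<Longrightarrow> B \<subseteq> S \<Longrightarrow> c A \<subseteq> c B"
    and "\<And>A. A \<subseteq> S \<Longrightarrow> c (c A) \<subseteq> c A"
    and "\<And>A x. A \<subseteq> S \<Longrightarrow> x \<in> c A \<Longrightarrow> \<exists>F. finite F \<and> F \<subseteq> A \<and> x \<in> c F"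
    and "\<And>A x y. A \<subseteq> S \<Longrightarrow> x \<in> S \<Longrightarrow> y \<in> S \<Longrightarrow> x \<in> c (insert y A) \<Longrightarrow> x \<notin> c A
           \<Longrightarrow> y \<in> c (insert x A)"
  shows "pregeometry S c"
proof -
  have idem: "c (c A) = c A" if "A \<subseteq> S" for A
    using assms(4)[OF that] assms(1)[OF assms(2)[OF that]] by (rule subset_antisym)
  show ?thesis
    unfolding pregeometry_def
    by (intro conjI allI impI; (elim conjE DiffE)?; rule assms idem; assumption)
qed

context
  fixes S :: "'a set" and c :: "'a set \<Rightarrow> 'a set"
  assumes pregeometry: "pregeometry S c"
begin

lemma cl_extensive: "A \<subseteq> S \<Longrightarrow> A \<subseteq> c A"
  and cl_in_carrier: "A \<subseteq> S \<Longrightarrow> c A \<subseteq> S"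
  and cl_mono: "A \<subseteq> B \<Longrightarrow> B \<subseteq> S \<Longrightarrow> c A \<subseteq> c B"
  and cl_idem: "A \<subseteq> S \<Longrightarrow> c (c A) = c A"
  and cl_finite_character:
    "A \<subseteq> S \<Longrightarrow> x \<in> c A \<Longrightarrow> \<exists>F. finite F \<and> F \<subseteq> A \<and> x \<in> c F"
  and cl_exchange:
    "A \<subseteq> S \<Longrightarrow> x \<in> S \<Longrightarrow> y \<in> S \<Longrightarrow> x \<in> c (insert y A) \<Longrightarrow> x \<notin> c A \<Longrightarrow> y \<in> c (insert x A)"
  using pregeometry unfolding pregeometry_def by simp_all

lemma cl_least: "A \<subseteq> c B \<Longrightarrow> B \<subseteq> S \<Longrightarrow> c A \<subseteq> c B"
  using cl_mono[of A "c B"] cl_in_carrier[of B] cl_idem[of B] by simp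

lemma pregeometry_localize:
  assumes "B \<subseteq> S"
  shows "pregeometry S (localize c B)"
  unfolding localize_def
proof (rule pregeometryI)
  fix A assume A: "A \<subseteq> S"
  have AB: "A \<union> B \<subseteq> S" using A assms by blast
  show "A \<subseteq> c (A \<union> B)" using cl_extensive[OF AB] by blast
  show "c (A \<union> B) \<subseteq> S" using cl_in_carrier[OF AB] .
  show "c (c (A \<union> B) \<union> B) \<subseteq> c (A \<union> B)"
    using cl_least[of "c (A \<union> B) \<union> B" "A \<union> B"] cl_extensive[OF AB] AB by blast
next
  fix A A' assume "A \<subseteq> A'" "A' \<subseteq> S"
  then show "c (A \<union> B) \<subseteq> c (A' \<union> B)" using assms by (intro cl_mono) auto
next
  fix A x assume A: "A \<subseteq> S" and "x \<in> c (A \<union> B)"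
  then obtain F where F: "finite F" "F \<subseteq> A \<union> B" "x \<in> c F"
    using cl_finite_character[of "A \<union> B" x] assms by blast
  have "c F \<subseteq> c ((F \<inter> A) \<union> B)" using F A assms by (intro cl_mono) auto
  with F show "\<exists>F. finite F \<and> F \<subseteq> A \<and> x \<in> c (F \<union> B)"
    by (intro exI[of _ "F \<inter> A"]) auto
next
  fix A x y
  assume "A \<subseteq> S" "x \<in> S" "y \<in> S" "x \<in> c (insert y A \<union> B)" "x \<notin> c (A \<union> B)"
  then show "y \<in> c (insert x A \<union> B)"
    using cl_exchange[of "A \<union> B" x y] assms by simp
qed

section \<open>Bases and dimension\<close>

lemma independent_insert:
  assumes Y: "cl_independent c Y" "Y \<subseteq> S" and z: "z \<in> S" "z \<notin> c Y"
  shows "cl_independent c (insert z Y)"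
  unfolding cl_independent_def
proof
  fix y assume y: "y \<in> insert z Y"
  have zY: "z \<notin> Y" using cl_extensive[OF Y(2)] z(2) by blast
  show "y \<notin> c (insert z Y - {y})"
  proof (cases "y = z")
    case True
    then show ?thesis using z(2) zY by simp
  next
    case False
    then have yY: "y \<in> Y" and eq: "insert z Y - {y} = insert z (Y - {y})"
      using y by auto
    show ?thesis
    proof
      assume "y \<in> c (insert z Y - {y})"
      then have "z \<in> c (insert y (Y - {y}))"
        using cl_exchange[of "Y - {y}" y z] Y z(1) yY eq
        unfolding cl_independent_def by auto
      then show False using z(2) yY by (simp add: insert_absorb)
    qed
  qed
qed

lemma independent_subset:
  assumes "cl_independent c Y" "X \<subseteq> Y" "Y \<subseteq> S"
  shows "cl_independent c X"
  unfolding cl_independent_def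
proof
  fix x assume x: "x \<in> X"
  have "c (X - {x}) \<subseteq> c (Y - {x})" using assms by (intro cl_mono) auto
  then show "x \<notin> c (X - {x})"
    using assms x unfolding cl_independent_def by blast
qed

text \<open>Steinitz exchange: as long as \<open>Y\<close> is not contained in \<open>Z\<close>, some element of \<open>Y - Z\<close> can be
  traded for one of \<open>Z\<close>, keeping \<open>Y\<close> independent and of the same size: if all of \<open>Z\<close> were in the
  closure of \<open>Y - {y}\<close>, then so would be \<open>y\<close>. Each trade decreases \<open>card (Y - Z)\<close>.\<close>

lemma independent_card_le:
  assumes "finite Y" "cl_independent c Y" "Y \<subseteq> c Z" "finite Z" "Z \<subseteq> S"
  shows "card Y \<le> card Z"
  using assms
proof (induction "card (Y - Z)" arbitrary: Y rule: less_induct)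
  case less
  have YS: "Y \<subseteq> S" using less.prems(3) cl_in_carrier[OF less.prems(5)] by (rule subset_trans)
  show ?case
  proof (cases "Y \<subseteq> Z")
    case True
    then show ?thesis using card_mono[OF less.prems(4)] by blast
  next
    case False
    then obtain y where y: "y \<in> Y" "y \<notin> Z" by blast
    let ?Y = "Y - {y}"
    have ynot: "y \<notin> c ?Y"
      using less.prems(2) y(1) unfolding cl_independent_def by blast
    have "\<not> Z \<subseteq> c ?Y"
    proof
      assume "Z \<subseteq> c ?Y"
      then have "c Z \<subseteq> c ?Y" using YS by (intro cl_least) auto
      then show False using ynot y(1) less.prems(3) by blast
    qed
    then obtain z where z: "z \<in> Z" "z \<notin> c ?Y" by blast
    have zY: "z \<notin> ?Y" using z(2) cl_extensive[of ?Y] YS by blast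
    have ind: "cl_independent c (insert z ?Y)"
    proof (rule independent_insert)
      show "cl_independent c ?Y" using independent_subset[OF less.prems(2) _ YS] by blast
    qed (use YS z less.prems(5) in auto)
    have "insert z ?Y - Z \<subset> Y - Z" using y z(1) by auto
    then have "card (insert z ?Y - Z) < card (Y - Z)"
      using less.prems(1) by (intro psubset_card_mono) auto
    moreover have "insert z ?Y \<subseteq> c Z"
      using less.prems(3) z(1) cl_extensive[OF less.prems(5)] by blast
    ultimately have "card (insert z ?Y) \<le> card Z"
      using less.hyps[OF _ _ ind _ less.prems(4,5)] less.prems(1) by simp
    moreover have "card (insert z ?Y) = card Y"
      using card_insert_disjoint[OF finite_Diff[OF less.prems(1)] zY]
        card.remove[OF less.prems(1) y(1)] by (rule trans[OF _ sym])
    ultimately show ?thesis by simp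
  qed
qed

lemma basis_exists:
  assumes "finite X" "X \<subseteq> S"
  shows "\<exists>Y. is_basis c X Y"
  using assms
proof (induction X rule: finite_induct)
  case empty
  show ?case unfolding is_basis_def cl_independent_def by auto
next
  case (insert x X)
  then obtain Y where Y: "Y \<subseteq> X" "cl_independent c Y" "X \<subseteq> c Y"
    unfolding is_basis_def by auto
  have YS: "Y \<subseteq> S" and xS: "x \<in> S" using Y insert.prems by auto
  show ?case
  proof (cases "x \<in> c Y")
    case True
    then show ?thesis using Y unfolding is_basis_def by blast
  next
    case False
    have "c Y \<subseteq> c (insert x Y)" "insert x Y \<subseteq> c (insert x Y)"
      using cl_mono[of Y "insert x Y"] cl_extensive[of "insert x Y"] YS xS by auto
    then have "is_basis c (insert x X) (insert x Y)"
      using Y independent_insert[OF Y(2) YS xS False] unfolding is_basis_def by blast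
    then show ?thesis by blast
  qed
qed

lemma basis_card_unique:
  assumes "finite X" "X \<subseteq> S" "is_basis c X Y" "is_basis c X Z"
  shows "card Y = card Z"
proof -
  have "finite Y" "finite Z" "Y \<subseteq> S" "Z \<subseteq> S" "Y \<subseteq> c Z" "Z \<subseteq> c Y"
    using assms unfolding is_basis_def by (auto intro: finite_subset)
  then show ?thesis
    using independent_card_le[of Y Z] independent_card_le[of Z Y] assms(3,4)
    unfolding is_basis_def by (simp add: le_antisym)
qed

lemma independent_Un:
  assumes "finite Z" "Z \<subseteq> S" "Y \<subseteq> S" "cl_independent c Y" "cl_independent (localize c Y) Z"
  shows "cl_independent c (Z \<union> Y) \<and> Z \<inter> Y = {}"
  using assms
proof (induction Z rule: finite_induct)
  case empty
  then show ?case by simp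
next
  case (insert z Z)
  have ZY: "Z \<union> Y \<subseteq> S" and zS: "z \<in> S" using insert.prems by auto
  have z: "z \<notin> c (Z \<union> Y)"
    using insert.prems(4) insert.hyps(2) unfolding cl_independent_def localize_def by simp
  have "c (Z - {x} \<union> Y) \<subseteq> c (insert z Z - {x} \<union> Y)" for x
    using ZY zS by (intro cl_mono) auto
  then have "cl_independent (localize c Y) Z"
    using insert.prems(4) unfolding cl_independent_def localize_def by blast
  then have IH: "cl_independent c (Z \<union> Y)" "Z \<inter> Y = {}"
    using insert.IH insert.prems by auto
  then show ?case
    using independent_insert[OF IH(1) ZY zS z] cl_extensive[OF ZY] z by auto
qed

end

lemma cl_dim_eq_card_basis:
  assumes "pregeometry S c" "B \<subseteq> S" "set xs \<subseteq> S" "is_basis (localize c B) (set xs) Y"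
  shows "cl_dim c xs B = card Y"
  unfolding cl_dim_def
  using basis_card_unique[OF pregeometry_localize[OF assms(1,2)] finite_set assms(3) _ assms(4)]
    someI[of "is_basis (localize c B) (set xs)", OF assms(4)] by blast

text \<open>The union of a basis of \<open>ys\<close> over \<open>B\<close> and a basis of \<open>xs\<close> over \<open>set ys \<union> B\<close> is a basis of the
  joint tuple over \<open>B\<close>.\<close>

lemma cl_dim_append:
  assumes pg: "pregeometry S c" and B: "B \<subseteq> S" and xs: "set xs \<subseteq> S" and ys: "set ys \<subseteq> S"
  shows "cl_dim c (xs @ ys) B = cl_dim c xs (set ys \<union> B) + cl_dim c ys B"
proof -
  have yB: "set ys \<union> B \<subseteq> S" using ys B by blast
  note pgB = pregeometry_localize[OF pg B] and pgyB = pregeometry_localize[OF pg yB]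
  obtain Y where Y: "is_basis (localize c B) (set ys) Y"
    using basis_exists[OF pgB finite_set ys] by blast
  obtain Z where Z: "is_basis (localize c (set ys \<union> B)) (set xs) Z"
    using basis_exists[OF pgyB finite_set xs] by blast
  have Yin: "Y \<subseteq> set ys" "set ys \<subseteq> c (Y \<union> B)" "cl_independent (localize c B) Y"
    and Zin: "Z \<subseteq> set xs" "set xs \<subseteq> c (Z \<union> (set ys \<union> B))"
      "cl_independent (localize c (set ys \<union> B)) Z"
    using Y Z unfolding is_basis_def localize_def by auto
  have fin: "finite Y" "finite Z" using Yin(1) Zin(1) finite_subset by blast+
  have YS: "Y \<subseteq> S" and ZS: "Z \<subseteq> S" and ZYB: "Z \<union> Y \<union> B \<subseteq> S"
    using Yin(1) Zin(1) xs ys B by auto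

  have "c (Z - {z} \<union> Y \<union> B) \<subseteq> c (Z - {z} \<union> (set ys \<union> B))" for z
    using Yin(1) ZS yB by (intro cl_mono[OF pg]) auto
  then have "cl_independent (localize (localize c B) Y) Z"
    using Zin(3) unfolding cl_independent_def localize_def by blast
  then have ind: "cl_independent (localize c B) (Z \<union> Y)" and disj: "Z \<inter> Y = {}"
    using independent_Un[OF pgB fin(2) ZS YS Yin(3)] by auto

  have "c (Y \<union> B) \<subseteq> c (Z \<union> Y \<union> B)"
    using ZYB by (intro cl_mono[OF pg]) auto
  then have ysc: "set ys \<subseteq> c (Z \<union> Y \<union> B)" using Yin(2) by blast
  then have "c (Z \<union> (set ys \<union> B)) \<subseteq> c (Z \<union> Y \<union> B)"
    using cl_extensive[OF pg ZYB] by (intro cl_least[OF pg _ ZYB]) blast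
  then have "is_basis (localize c B) (set (xs @ ys)) (Z \<union> Y)"
    using Yin(1) Zin(1,2) ysc ind unfolding is_basis_def localize_def by auto
  then have "cl_dim c (xs @ ys) B = card (Z \<union> Y)"
    using cl_dim_eq_card_basis[OF pg B] xs ys by simp
  also have "\<dots> = card Z + card Y" using fin disj by (simp add: card_Un_disjoint)
  finally show ?thesis
    using cl_dim_eq_card_basis[OF pg B ys Y] cl_dim_eq_card_basis[OF pg yB xs Z] by simp
qed

lemma cl_dim_symmetric:
  assumes "pregeometry S c" "B \<subseteq> S" "set xs \<subseteq> S" "set ys \<subseteq> S"
    and "cl_dim c xs B = cl_dim c xs (set ys \<union> B)"
  shows "cl_dim c ys B = cl_dim c ys (set xs \<union> B)"
proof -
  have "cl_dim c (xs @ ys) B = cl_dim c (ys @ xs) B"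
    unfolding cl_dim_def by (simp add: Un_commute)
  then show ?thesis
    using cl_dim_append[OF assms(1-4)] cl_dim_append[OF assms(1,2,4,3)] assms(5) by simp
qed

section \<open>Members of a quasiminimal class are pregeometries\<close>

lemma pregeometry_isomorphic:
  assumes pg: "pregeometry (carr M) (cl M)" and iso: "isomorphism L h M N"
  shows "pregeometry (carr N) (cl N)"
proof -
  have inj: "inj_on h (carr M)" and img: "h ` carr M = carr N"
    and cl: "\<And>A. A \<subseteq> carr M \<Longrightarrow> cl N (h ` A) = h ` cl M A"
    using iso unfolding isomorphism_def closed_embedding_def embedding_def by auto
  have pull: "\<exists>A'\<subseteq>carr M. A = h ` A'" if "A \<subseteq> carr N" for A
    using that img by (metis subset_image_iff)
  have mem: "h x \<in> h ` A \<longleftrightarrow> x \<in> A" if "x \<in> carr M" "A \<subseteq> carr M" for x A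
    using inj_on_image_mem_iff[OF inj that] .
  note sub = cl_in_carrier[OF pg]
  show ?thesis
  proof (rule pregeometryI)
    fix A assume "A \<subseteq> carr N"
    then obtain A' where A': "A' \<subseteq> carr M" "A = h ` A'" using pull by blast
    show "A \<subseteq> cl N A" using A' cl cl_extensive[OF pg] by (simp add: image_mono)
    show "cl N A \<subseteq> carr N" using A' cl sub img by (metis image_mono)
    show "cl N (cl N A) \<subseteq> cl N A"
      using A' cl[OF A'(1)] cl[OF sub[OF A'(1)]] cl_idem[OF pg A'(1)] by simp
  next
    fix A B assume AB: "A \<subseteq> B" "B \<subseteq> carr N"
    obtain B' where B': "B' \<subseteq> carr M" "B = h ` B'" using pull[OF AB(2)] by blast
    obtain A' where A': "A' \<subseteq> B'" "A = h ` A'" using AB(1) B'(2) by (metis subset_image_iff)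
    have "cl M A' \<subseteq> cl M B'" using cl_mono[OF pg A'(1) B'(1)] .
    then show "cl N A \<subseteq> cl N B"
      using cl[of A'] cl[of B'] A' B' by (metis image_mono subset_trans)
  next
    fix A x assume "A \<subseteq> carr N" and x: "x \<in> cl N A"
    then obtain A' where A': "A' \<subseteq> carr M" "A = h ` A'" using pull by blast
    then obtain x' where x': "x' \<in> cl M A'" "x = h x'" using x cl by auto
    obtain F where F: "finite F" "F \<subseteq> A'" "x' \<in> cl M F"
      using cl_finite_character[OF pg A'(1) x'(1)] by blast
    then have "x \<in> cl N (h ` F)" using cl[of F] A' x' by auto
    then show "\<exists>F. finite F \<and> F \<subseteq> A \<and> x \<in> cl N F"
      using F A' by (intro exI[of _ "h ` F"]) auto
  next
    fix A x y
    assume A: "A \<subseteq> carr N" and xN: "x \<in> carr N" and yN: "y \<in> carr N"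
      and x: "x \<in> cl N (insert y A)" "x \<notin> cl N A"
    obtain A' where A': "A' \<subseteq> carr M" "A = h ` A'" using pull[OF A] by blast
    obtain x' where x': "x' \<in> carr M" "x = h x'" using xN img by blast
    obtain y' where y': "y' \<in> carr M" "y = h y'" using yN img by blast
    have ins: "cl N (insert (h z) A) = h ` cl M (insert z A')" "insert z A' \<subseteq> carr M"
      if "z \<in> carr M" for z
      using cl[of "insert z A'"] that A' by auto
    have "x' \<in> cl M (insert y' A')" "x' \<notin> cl M A'"
      using x ins[OF y'(1)] cl[OF A'(1)] mem[OF x'(1)] sub A' x' y' by auto
    then show "y \<in> cl N (insert x A)"
      using cl_exchange[OF pg A'(1) x'(1) y'(1)] ins[OF x'(1)] x' y' by auto
  qed
qed

lemma closed_sub_cl: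
  assumes "closed_sub L N M" "A \<subseteq> carr N"
  shows "cl N A = cl M A" "cl N A \<subseteq> carr N"
  using assms unfolding closed_sub_def closed_embedding_def by - (simp, blast)

lemma pregeometry_closed_sub:
  assumes pg: "pregeometry (carr M) (cl M)" and sub: "closed_sub L N M"
  shows "pregeometry (carr N) (cl N)"
proof -
  have NM: "carr N \<subseteq> carr M" using sub unfolding closed_sub_def by blast
  note cl = closed_sub_cl(1)[OF sub] and incl = closed_sub_cl(2)[OF sub]
  show ?thesis
  proof (rule pregeometryI)
    fix A assume A: "A \<subseteq> carr N"
    show "A \<subseteq> cl N A" using cl[OF A] cl_extensive[OF pg] A NM by auto
    show "cl N A \<subseteq> carr N" using incl[OF A] .
    show "cl N (cl N A) \<subseteq> cl N A"
      using cl[OF A] cl[OF incl[OF A]] cl_idem[OF pg] A NM by auto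
  next
    fix A B assume "A \<subseteq> B" "B \<subseteq> carr N"
    then show "cl N A \<subseteq> cl N B"
      using cl[of A] cl[of B] cl_mono[OF pg, of A B] NM by auto
  next
    fix A x assume A: "A \<subseteq> carr N" "x \<in> cl N A"
    then obtain F where F: "finite F" "F \<subseteq> A" "x \<in> cl M F"
      using cl_finite_character[OF pg, of A x] cl[of A] NM by auto
    then show "\<exists>F. finite F \<and> F \<subseteq> A \<and> x \<in> cl N F"
      using cl[of F] A by auto
  next
    fix A x y
    assume "A \<subseteq> carr N" "x \<in> carr N" "y \<in> carr N" "x \<in> cl N (insert y A)" "x \<notin> cl N A"
    then show "y \<in> cl N (insert x A)"
      using cl_exchange[OF pg, of A x y] cl[of A] cl[of "insert x A"] cl[of "insert y A"]
        subset_trans[OF _ NM, of A] subsetD[OF NM, of x] subsetD[OF NM, of y] by simp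
  qed
qed

lemma pregeometry_chain_union:
  fixes N :: "('a, 'b, 'c) clstruct"
  assumes pg: "\<And>M. M \<in> K \<Longrightarrow> pregeometry (carr M) (cl M)" and un: "chain_union L K N"
  shows "pregeometry (carr N) (cl N)"
proof -
  have ne: "K \<noteq> {}"
    and chain: "\<And>M1 M2. M1 \<in> K \<Longrightarrow> M2 \<in> K \<Longrightarrow> closed_sub L M1 M2 \<or> closed_sub L M2 M1"
    and carr: "carr N = (\<Union>M\<in>K. carr M)"
    and cl: "\<And>A. A \<subseteq> carr N \<Longrightarrow> cl N A = (\<Union>M\<in>K. cl M (A \<inter> carr M))"
    and sub: "\<And>M. M \<in> K \<Longrightarrow> closed_sub L M N"
    using un unfolding chain_union_def by auto
  note cleq = closed_sub_cl(1)[OF sub] and incl = closed_sub_cl(2)[OF sub]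
  have clK: "cl M (A \<inter> carr M) \<subseteq> cl N A" if "M \<in> K" "A \<subseteq> carr N" for M A
    using that cl by blast
  have clN: "cl N A \<subseteq> carr N" if "A \<subseteq> carr N" for A
    unfolding cl[OF that] carr using incl[OF _ Int_lower2] by (rule UN_mono[OF order_refl])
  have mono: "cl N A \<subseteq> cl N B" if "A \<subseteq> B" "B \<subseteq> carr N" for A B
  proof -
    have "cl M (A \<inter> carr M) \<subseteq> cl M (B \<inter> carr M)" if "M \<in> K" for M
      using \<open>A \<subseteq> B\<close> by (intro cl_mono[OF pg[OF that]]) auto
    then show ?thesis
      unfolding cl[OF that(2)] cl[OF subset_trans[OF that]] by (rule UN_mono[OF order_refl])
  qed
  show ?thesis
  proof (rule pregeometryI)
    fix A assume A: "A \<subseteq> carr N"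
    show "cl N A \<subseteq> carr N" using clN[OF A] .
    show "A \<subseteq> cl N A"
    proof
      fix x assume x: "x \<in> A"
      then obtain M where M: "M \<in> K" "x \<in> carr M" using A carr by blast
      then show "x \<in> cl N A"
        using cl_extensive[OF pg[OF M(1)], of "A \<inter> carr M"] clK[OF M(1) A] x by blast
    qed
    show "cl N (cl N A) \<subseteq> cl N A"
    proof
      fix x assume "x \<in> cl N (cl N A)"
      then obtain M where M: "M \<in> K" "x \<in> cl M (cl N A \<inter> carr M)"
        using cl[OF clN[OF A]] by blast
      then obtain F where F: "finite F" "F \<subseteq> cl N A \<inter> carr M" "x \<in> cl M F"
        using cl_finite_character[OF pg[OF M(1)], of "cl N A \<inter> carr M" x] by blast
      define D where "D = (\<lambda>M :: ('a, 'b, 'c) clstruct. cl M (A \<inter> carr M))"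
      have Dmono: "D M1 \<subseteq> D M2" if "M1 \<in> K" "M2 \<in> K" "closed_sub L M1 M2" for M1 M2
      proof -
        have "cl M1 (A \<inter> carr M1) = cl M2 (A \<inter> carr M1)"
          using closed_sub_cl(1)[OF that(3), of "A \<inter> carr M1"] by simp
        moreover have "carr M1 \<subseteq> carr M2" using that(3) unfolding closed_sub_def by blast
        ultimately show ?thesis
          unfolding D_def using cl_mono[OF pg[OF that(2)], of "A \<inter> carr M1" "A \<inter> carr M2"] by blast
      qed
      have "subset.chain UNIV (D ` K)"
        unfolding subset_chain_def using chain Dmono by blast
      moreover have "F \<subseteq> \<Union>(D ` K)" using F(2) cl[OF A] unfolding D_def by blast
      \<comment> \<open>By finiteness all of \<open>F\<close> already lies in the closure of \<open>A\<close> computed in one member \<open>M'\<close>.\<close>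
      ultimately obtain E where "E \<in> D ` K" "F \<subseteq> E"
        using finite_subset_Union_chain[OF F(1), of "D ` K" UNIV] ne by (metis image_is_empty)
      then obtain M' where M': "M' \<in> K" "F \<subseteq> cl M' (A \<inter> carr M')"
        unfolding D_def by blast
      have "F \<subseteq> carr M'" using M' incl[OF M'(1), of "A \<inter> carr M'"] by blast
      then have "x \<in> cl M' F"
        using F(2,3) cleq[OF M(1), of F] cleq[OF M'(1), of F] by auto
      then have "x \<in> cl M' (A \<inter> carr M')"
        using cl_least[OF pg[OF M'(1)] M'(2)] by auto
      then show "x \<in> cl N A" using clK[OF M'(1) A] by blast
    qed
  next
    fix A B assume "A \<subseteq> B" "B \<subseteq> carr N"
    then show "cl N A \<subseteq> cl N B" using mono by blast
  next
    fix A x assume A: "A \<subseteq> carr N" "x \<in> cl N A"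
    then obtain M where M: "M \<in> K" "x \<in> cl M (A \<inter> carr M)"
      unfolding cl[OF A(1)] by blast
    then obtain F where F: "finite F" "F \<subseteq> A \<inter> carr M" "x \<in> cl M F"
      using cl_finite_character[OF pg[OF M(1)], of "A \<inter> carr M" x] by blast
    then show "\<exists>F. finite F \<and> F \<subseteq> A \<and> x \<in> cl N F"
      using cleq[OF M(1), of F] by auto
  next
    fix A x y
    assume A: "A \<subseteq> carr N" and xN: "x \<in> carr N" and yN: "y \<in> carr N"
      and x: "x \<in> cl N (insert y A)" "x \<notin> cl N A"
    have yA: "insert y A \<subseteq> carr N" and xA: "insert x A \<subseteq> carr N" using A xN yN by auto
    obtain M where M: "M \<in> K" "x \<in> cl M (insert y A \<inter> carr M)"
      using x(1) cl[OF yA] by blast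
    have nx: "x \<notin> cl M (A \<inter> carr M)" using clK[OF M(1) A] x(2) by blast
    \<comment> \<open>Otherwise \<open>y\<close> would not contribute to the closure in \<open>M\<close>.\<close>
    have yM: "y \<in> carr M"
    proof (rule ccontr)
      assume "y \<notin> carr M"
      then have "insert y A \<inter> carr M = A \<inter> carr M" by blast
      then show False using M(2) nx by simp
    qed
    have xM: "x \<in> carr M" using M incl[OF M(1), of "insert y A \<inter> carr M"] by blast
    have "y \<in> cl M (insert x (A \<inter> carr M))"
      using cl_exchange[OF pg[OF M(1)], of "A \<inter> carr M" x y] M(2) nx xM yM by simp
    moreover have "insert x (A \<inter> carr M) = insert x A \<inter> carr M" using xM by blast
    ultimately show "y \<in> cl N (insert x A)" using clK[OF M(1) xA] by auto
  qed
qed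

lemma pregeometry_generated_class:
  assumes "M \<in> generated_class L M0" "pregeometry (carr M0) (cl M0)"
  shows "pregeometry (carr M) (cl M)"
  using assms
proof (induction rule: generated_class.induct)
  case base
  then show ?case .
next
  case (iso M h N)
  then show ?case using pregeometry_isomorphic by blast
next
  case (sub M N)
  then show ?case using pregeometry_closed_sub by blast
next
  case (union K N)
  then show ?case using pregeometry_chain_union[of K L N] by blast
qed

lemma pregeometry_quasiminimal_class:
  assumes "quasiminimal_class L \<C>" "M \<in> \<C>"
  shows "pregeometry (carr M) (cl M)"
  using assms pregeometry_generated_class
  unfolding quasiminimal_class_def qm_pregeometry_structure_def
    weakly_qm_pregeometry_structure_def by blast

section \<open>Symmetry\<close>

theorem lemma5p20:
  fixes L :: "('f, 'r) lang"
    and \<C> :: "('a, 'f, 'r) clstruct set"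
    and M :: "('a, 'f, 'r) clstruct"
    and P C :: "'a set"
    and as bs :: "'a list"
  assumes "countable_language L"
    and "quasiminimal_class L \<C>"
    and "modular_class \<C>"
    and "beautiful_pair L \<C> M P"
    and "set as \<subseteq> carr M" and "set bs \<subseteq> carr M" and "C \<subseteq> carr M"
    and "indep_clP M P as C (set bs)"
  shows "indep_clP M P bs C (set as)"
proof -
  have pg: "pregeometry (carr M) (cl M)" and P: "P \<subseteq> carr M"
    using assms(2,4) pregeometry_quasiminimal_class unfolding beautiful_pair_def by blast+
  have CP: "C \<union> P \<subseteq> carr M" using assms(7) P by blast
  have "cl_dim (cl M) as C = cl_dim (cl M) as (set bs \<union> C)"
    and "cl_dim (cl M) as (C \<union> P) = cl_dim (cl M) as (set bs \<union> (C \<union> P))"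
    using assms(8) unfolding indep_clP_def indep_clP_sub_def dim_scl_def
    by (simp_all add: ac_simps)
  then have "cl_dim (cl M) bs C = cl_dim (cl M) bs (set as \<union> C)"
    and "cl_dim (cl M) bs (C \<union> P) = cl_dim (cl M) bs (set as \<union> (C \<union> P))"
    using cl_dim_symmetric[OF pg assms(7,5,6)] cl_dim_symmetric[OF pg CP assms(5,6)] by blast+
  then show ?thesis
    unfolding indep_clP_def indep_clP_sub_def dim_scl_def by (simp add: ac_simps)
qed

end
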